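(* Let $\Gamma$ be a finitely generated infinite group, let $Z(\Gamma)$ be its centre, $K(\Gamma)$ its $FC$-centre, and let $\theta: \mathrm{Aut}(\Gamma)\to QI(\Gamma)$ be the natural homomorphism sending an automorphism to its class as a quasi-isometry. If $\theta$ is a monomorphism, then $K(\Gamma)=Z(\Gamma)$. The converse holds if $K(\Gamma)=Z(\Gamma)$ is torsion free: that is, if $K(\Gamma)=Z(\Gamma)$ and this group is torsion free, then $\theta$ is a monomorphism.
   Context: The $FC$-centre of a group $\Gamma$ is the subgroup $K(\Gamma)=\{\gamma\in\Gamma : [\Gamma:C(\gamma)]<\infty\}$, where $C(\gamma)$ is the centralizer of $\gamma$ in $\Gamma$. A map $f:X\to X'$ (not assumed continuous) between metric spaces $(X,d)$, $(X',d')$ is a quasi-isometry if there are constants $\lambda\ge 1$, $\epsilon\ge 0$, $C\ge 0$ such that $\lambda^{-1}d(x,y)-\epsilon\le d'(f(x),f(y))\le \lambda d(x,y)+\epsilon$ for all $x,y\in X$ and every point of $X'$ is within distance $C$ of the image of $f$. Two maps $f,g:X\to X'$ are quasi-isometrically equivalent if there is a constant $c$ with $d'(f(x),g(x))\le c$ for all $x\in X$. $QI(X)$ is the group, under composition, of equivalence classes $[f]$ of quasi-isometries $f:X\to X$. For a finitely generated group $\Gamma$, $QI(\Gamma)$ is defined using the word metric $d(\gamma,\gamma')=$ length of $\gamma^{-1}\gamma'$ with respect to a fixed finite generating set (the result does not depend on this choice). Every automorphism $\phi$ of $\Gamma$ is a quasi-isometry, and $\theta(\phi)=[\phi]$. 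*)

theory Defs
  imports "HOL-Algebra.Algebra" "HOL-Analysis.Abstract_Metric_Spaces"
begin

section \<open>Centre, FC-centre and torsion\<close>

definition centralizer :: "('a, 'b) monoid_scheme \<Rightarrow> 'a \<Rightarrow> 'a set" where
  "centralizer G a = {g \<in> carrier G. g \<otimes>\<^bsub>G\<^esub> a = a \<otimes>\<^bsub>G\<^esub> g}"

definition center :: "('a, 'b) monoid_scheme \<Rightarrow> 'a set" where
  "center G = {z \<in> carrier G. \<forall>g \<in> carrier G. z \<otimes>\<^bsub>G\<^esub> g = g \<otimes>\<^bsub>G\<^esub> z}"

definition FC_center :: "('a, 'b) monoid_scheme \<Rightarrow> 'a set" where
  "FC_center G = {a \<in> carrier G. finite (rcosets\<^bsub>G\<^esub> (centralizer G a))}"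

definition torsion_free :: "('a, 'b) monoid_scheme \<Rightarrow> bool" where
  "torsion_free G \<longleftrightarrow>
     (\<forall>a \<in> carrier G. \<forall>n::nat. n > 0 \<longrightarrow> a [^]\<^bsub>G\<^esub> n = \<one>\<^bsub>G\<^esub> \<longrightarrow> a = \<one>\<^bsub>G\<^esub>)"


section \<open>Quasi-isometries and the group \<open>QI(X)\<close>\<close>

definition quasi_isometry ::
    "'a set \<Rightarrow> ('a \<Rightarrow> 'a \<Rightarrow> real) \<Rightarrow> 'b set \<Rightarrow> ('b \<Rightarrow> 'b \<Rightarrow> real) \<Rightarrow> ('a \<Rightarrow> 'b) \<Rightarrow> bool" where
  "quasi_isometry M d M' d' f \<longleftrightarrow> f \<in> M \<rightarrow> M' \<and>
     (\<exists>l e C. l \<ge> 1 \<and> e \<ge> 0 \<and> C \<ge> 0 \<and>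
        (\<forall>x \<in> M. \<forall>y \<in> M. inverse l * d x y - e \<le> d' (f x) (f y) \<and>
                             d' (f x) (f y) \<le> l * d x y + e) \<and>
        (\<forall>z \<in> M'. \<exists>x \<in> M. d' z (f x) \<le> C))"

definition qi_equivalent ::
    "'a set \<Rightarrow> ('b \<Rightarrow> 'b \<Rightarrow> real) \<Rightarrow> ('a \<Rightarrow> 'b) \<Rightarrow> ('a \<Rightarrow> 'b) \<Rightarrow> bool" where
  "qi_equivalent M d' f g \<longleftrightarrow> (\<exists>c. \<forall>x \<in> M. d' (f x) (g x) \<le> c)"

text \<open>As for \<^const>\<open>Bij\<close>, self-maps of \<open>M\<close> are represented by extensional functions.\<close>

definition QI_maps :: "'a set \<Rightarrow> ('a \<Rightarrow> 'a \<Rightarrow> real) \<Rightarrow> ('a \<Rightarrow> 'a) set" where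
  "QI_maps M d = {f \<in> extensional M. quasi_isometry M d M d f}"

definition QI_rel :: "'a set \<Rightarrow> ('a \<Rightarrow> 'a \<Rightarrow> real) \<Rightarrow> (('a \<Rightarrow> 'a) \<times> ('a \<Rightarrow> 'a)) set" where
  "QI_rel M d = {(f, g). f \<in> QI_maps M d \<and> g \<in> QI_maps M d \<and> qi_equivalent M d f g}"

definition QI_class :: "'a set \<Rightarrow> ('a \<Rightarrow> 'a \<Rightarrow> real) \<Rightarrow> ('a \<Rightarrow> 'a) \<Rightarrow> ('a \<Rightarrow> 'a) set" where
  "QI_class M d f = QI_rel M d `` {f}"

text \<open>The union in the product is over equal sets, so that \<open>[f] \<cdot> [g] = [f \<circ> g]\<close>;
  see \<open>QI_class_mult\<close> below.\<close>

definition QI_group :: "'a set \<Rightarrow> ('a \<Rightarrow> 'a \<Rightarrow> real) \<Rightarrow> ('a \<Rightarrow> 'a) set monoid" where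
  "QI_group M d =
     \<lparr>carrier = QI_maps M d // QI_rel M d,
      monoid.mult = \<lambda>A B. \<Union>f \<in> A. \<Union>g \<in> B. QI_class M d (compose M f g),
      one = QI_class M d (\<lambda>x \<in> M. x)\<rparr>"


section \<open>The word metric and the natural map\<close>

definition word_length :: "('a, 'b) monoid_scheme \<Rightarrow> 'a set \<Rightarrow> 'a \<Rightarrow> nat" where
  "word_length G S g =
     (LEAST n. \<exists>ws. length ws = n \<and> set ws \<subseteq> S \<union> m_inv G ` S \<and>
                    foldr (\<otimes>\<^bsub>G\<^esub>) ws \<one>\<^bsub>G\<^esub> = g)"

text \<open>The value \<open>0\<close> outside the carrier only serves to meet the unrelativised axioms of
  \<^locale>\<open>Metric_space\<close>.\<close>

definition word_dist :: "('a, 'b) monoid_scheme \<Rightarrow> 'a set \<Rightarrow> 'a \<Rightarrow> 'a \<Rightarrow> real" where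
  "word_dist G S x y =
     (if x \<in> carrier G \<and> y \<in> carrier G
      then real (word_length G S (inv\<^bsub>G\<^esub> x \<otimes>\<^bsub>G\<^esub> y)) else 0)"

abbreviation QI :: "('a, 'b) monoid_scheme \<Rightarrow> 'a set \<Rightarrow> ('a \<Rightarrow> 'a) set monoid" where
  "QI G S \<equiv> QI_group (carrier G) (word_dist G S)"

definition theta :: "('a, 'b) monoid_scheme \<Rightarrow> 'a set \<Rightarrow> ('a \<Rightarrow> 'a) \<Rightarrow> ('a \<Rightarrow> 'a) set" where
  "theta G S \<phi> = QI_class (carrier G) (word_dist G S) \<phi>"


section \<open>These notions are well defined\<close>

lemma QI_mapsI:
  assumes "f \<in> extensional M" "f \<in> M \<rightarrow> M" "l \<ge> 1" "e \<ge> 0" "C \<ge> 0"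
    and "\<And>x y. x \<in> M \<Longrightarrow> y \<in> M \<Longrightarrow> d x y \<le> l * d (f x) (f y) + e"
    and "\<And>x y. x \<in> M \<Longrightarrow> y \<in> M \<Longrightarrow> d (f x) (f y) \<le> l * d x y + e"
    and "\<And>z. z \<in> M \<Longrightarrow> \<exists>x \<in> M. d z (f x) \<le> C"
  shows "f \<in> QI_maps M d"
proof -
  have "inverse l * d x y - e \<le> d (f x) (f y)" if "x \<in> M" "y \<in> M" for x y
  proof -
    have "inverse l * d x y \<le> inverse l * (l * d (f x) (f y) + e)"
      using assms(3) assms(6)[OF that] by (intro mult_left_mono) auto
    also have "\<dots> = d (f x) (f y) + inverse l * e"
      using assms(3) by (simp add: field_simps)
    also have "inverse l * e \<le> 1 * e"
      using assms(3,4) by (intro mult_right_mono) (auto simp: field_simps)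
    finally show ?thesis by simp
  qed
  then have "\<forall>x \<in> M. \<forall>y \<in> M. inverse l * d x y - e \<le> d (f x) (f y) \<and>
      d (f x) (f y) \<le> l * d x y + e"
    using assms(7) by blast
  moreover have "\<forall>z \<in> M. \<exists>x \<in> M. d z (f x) \<le> C"
    using assms(8) by blast
  ultimately have "quasi_isometry M d M d f"
    unfolding quasi_isometry_def using assms(2-5) by metis
  with assms(1) show ?thesis
    by (simp add: QI_maps_def)
qed

lemma QI_mapsE:
  assumes "f \<in> QI_maps M d"
  obtains l e C where "f \<in> extensional M" "f \<in> M \<rightarrow> M" "l \<ge> 1" "e \<ge> 0" "C \<ge> 0"
    "\<And>x y. x \<in> M \<Longrightarrow> y \<in> M \<Longrightarrow> d x y \<le> l * d (f x) (f y) + e"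
    "\<And>x y. x \<in> M \<Longrightarrow> y \<in> M \<Longrightarrow> d (f x) (f y) \<le> l * d x y + e"
    "\<And>z. z \<in> M \<Longrightarrow> \<exists>x \<in> M. d z (f x) \<le> C"
proof -
  obtain l e C where *: "f \<in> extensional M" "f \<in> M \<rightarrow> M" "l \<ge> 1" "e \<ge> 0" "C \<ge> 0"
    "\<And>x y. x \<in> M \<Longrightarrow> y \<in> M \<Longrightarrow> inverse l * d x y - e \<le> d (f x) (f y)"
    "\<And>x y. x \<in> M \<Longrightarrow> y \<in> M \<Longrightarrow> d (f x) (f y) \<le> l * d x y + e"
    "\<And>z. z \<in> M \<Longrightarrow> \<exists>x \<in> M. d z (f x) \<le> C"
    using assms unfolding QI_maps_def quasi_isometry_def by blast
  have 1: "d x y \<le> l * d (f x) (f y) + l * e" if "x \<in> M" "y \<in> M" for x y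
  proof -
    have "l * (inverse l * d x y - e) \<le> l * d (f x) (f y)"
      using *(3) *(6)[OF that] by (intro mult_left_mono) auto
    moreover have "l * (inverse l * d x y - e) = d x y - l * e"
      using *(3) by (simp add: right_diff_distrib)
    ultimately show ?thesis by linarith
  qed
  have el: "e \<le> l * e"
    using *(3,4) by (simp add: mult_le_cancel_right1)
  have 2: "d (f x) (f y) \<le> l * d x y + l * e" if "x \<in> M" "y \<in> M" for x y
    using *(7)[OF that] el by linarith
  show thesis
    by (rule that[of l "l * e" C]) (use * 1 2 in \<open>auto\<close>)
qed

context Metric_space
begin

lemma equiv_QI_rel: "equiv (QI_maps M d) (QI_rel M d)"
proof (rule equivI)
  show "QI_rel M d \<subseteq> QI_maps M d \<times> QI_maps M d"
    by (auto simp: QI_rel_def)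
  have "qi_equivalent M d f f" if "f \<in> QI_maps M d" for f
    unfolding qi_equivalent_def using that
    by (intro exI[of _ 0]) (auto simp: QI_maps_def quasi_isometry_def Pi_iff)
  then show "refl_on (QI_maps M d) (QI_rel M d)"
    by (auto simp: refl_on_def QI_rel_def)
  show "sym (QI_rel M d)"
    by (auto simp: sym_def QI_rel_def qi_equivalent_def commute)
  show "trans (QI_rel M d)"
  proof (rule transI)
    fix f g h
    assume "(f, g) \<in> QI_rel M d" "(g, h) \<in> QI_rel M d"
    then obtain a b where *: "f \<in> QI_maps M d" "g \<in> QI_maps M d" "h \<in> QI_maps M d"
      "\<forall>x \<in> M. d (f x) (g x) \<le> a" "\<forall>x \<in> M. d (g x) (h x) \<le> b"
      by (auto simp: QI_rel_def qi_equivalent_def)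
    then have M: "f x \<in> M" "g x \<in> M" "h x \<in> M" if "x \<in> M" for x
      using that by (auto simp: QI_maps_def quasi_isometry_def)
    have "d (f x) (h x) \<le> a + b" if "x \<in> M" for x
      using triangle[OF M[OF that]] *(4,5) that by fastforce
    then show "(f, h) \<in> QI_rel M d"
      using * by (auto simp: QI_rel_def qi_equivalent_def)
  qed
qed

lemma QI_maps_id: "(\<lambda>x \<in> M. x) \<in> QI_maps M d"
  by (rule QI_mapsI[where l = 1 and e = 0 and C = 0]) (auto, metis order_refl zero)

lemma QI_maps_compose:
  assumes "f \<in> QI_maps M d" "g \<in> QI_maps M d"
  shows "compose M f g \<in> QI_maps M d"
proof -
  obtain l e C where f: "f \<in> extensional M" "f \<in> M \<rightarrow> M" "l \<ge> 1" "e \<ge> 0" "C \<ge> 0"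
    "\<And>x y. x \<in> M \<Longrightarrow> y \<in> M \<Longrightarrow> d x y \<le> l * d (f x) (f y) + e"
    "\<And>x y. x \<in> M \<Longrightarrow> y \<in> M \<Longrightarrow> d (f x) (f y) \<le> l * d x y + e"
    "\<And>z. z \<in> M \<Longrightarrow> \<exists>x \<in> M. d z (f x) \<le> C"
    using assms(1) by (rule QI_mapsE) blast
  obtain l' e' C' where g: "g \<in> extensional M" "g \<in> M \<rightarrow> M" "l' \<ge> 1" "e' \<ge> 0" "C' \<ge> 0"
    "\<And>x y. x \<in> M \<Longrightarrow> y \<in> M \<Longrightarrow> d x y \<le> l' * d (g x) (g y) + e'"
    "\<And>x y. x \<in> M \<Longrightarrow> y \<in> M \<Longrightarrow> d (g x) (g y) \<le> l' * d x y + e'"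
    "\<And>z. z \<in> M \<Longrightarrow> \<exists>x \<in> M. d z (g x) \<le> C'"
    using assms(2) by (rule QI_mapsE) blast
  have fM: "f x \<in> M" and gM: "g x \<in> M" if "x \<in> M" for x
    using f(2) g(2) that by auto
  have le: "l * e' + e \<le> l * e' + e + l' * e + e'" "l' * e + e' \<le> l * e' + e + l' * e + e'"
    using f(3,4) g(3,4) by auto
  show ?thesis
  proof (rule QI_mapsI[where l = "l * l'" and e = "l * e' + e + l' * e + e'"
        and C = "C + l * C' + e"])
    show "compose M f g \<in> extensional M" by simp
    show "compose M f g \<in> M \<rightarrow> M" using fM gM by (auto simp: compose_def)
    show "1 \<le> l * l'" using f(3) g(3) by (metis mult_mono' mult_1 zero_le_one)
    show "0 \<le> l * e' + e + l' * e + e'" "0 \<le> C + l * C' + e" using f g by auto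
  next
    fix x y assume xy: "x \<in> M" "y \<in> M"
    have "d x y \<le> l' * d (g x) (g y) + e'" using g(6) xy .
    also have "\<dots> \<le> l' * (l * d (f (g x)) (f (g y)) + e) + e'"
      using g(3) f(6)[OF gM gM, OF xy] by (intro add_right_mono mult_left_mono) auto
    also have "\<dots> = l * l' * d (f (g x)) (f (g y)) + (l' * e + e')" by (simp add: algebra_simps)
    finally show "d x y \<le> l * l' * d (compose M f g x) (compose M f g y) +
        (l * e' + e + l' * e + e')"
      using le xy by (simp add: compose_eq)
    have "d (f (g x)) (f (g y)) \<le> l * d (g x) (g y) + e" using f(7)[OF gM gM, OF xy] .
    also have "\<dots> \<le> l * (l' * d x y + e') + e"
      using f(3) g(7)[OF xy] by (intro add_right_mono mult_left_mono) auto
    also have "\<dots> = l * l' * d x y + (l * e' + e)" by (simp add: algebra_simps)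
    finally show "d (compose M f g x) (compose M f g y) \<le> l * l' * d x y +
        (l * e' + e + l' * e + e')"
      using le xy by (simp add: compose_eq)
  next
    fix z assume z: "z \<in> M"
    obtain y where y: "y \<in> M" "d z (f y) \<le> C" using f(8) z by blast
    obtain x where x: "x \<in> M" "d y (g x) \<le> C'" using g(8) y by blast
    have "d z (f (g x)) \<le> d z (f y) + d (f y) (f (g x))"
      by (intro triangle z fM gM x y)
    also have "d (f y) (f (g x)) \<le> l * d y (g x) + e" using f(7) y gM x by blast
    also have "l * d y (g x) \<le> l * C'" using x f(3) by (intro mult_left_mono) auto
    finally show "\<exists>x \<in> M. d z (compose M f g x) \<le> C + l * C' + e"
      using y x by (intro bexI[of _ x]) (auto simp: compose_eq)
  qed
qed

lemma QI_rel_compose: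
  assumes "(f, f') \<in> QI_rel M d" "(g, g') \<in> QI_rel M d"
  shows "(compose M f g, compose M f' g') \<in> QI_rel M d"
proof -
  have fg: "f \<in> QI_maps M d" "f' \<in> QI_maps M d" "g \<in> QI_maps M d" "g' \<in> QI_maps M d"
    using assms by (auto simp: QI_rel_def)
  then have in_M: "f x \<in> M" "f' x \<in> M" "g x \<in> M" "g' x \<in> M" if "x \<in> M" for x
    using that by (auto simp: QI_maps_def quasi_isometry_def)
  obtain a b where ab: "\<And>x. x \<in> M \<Longrightarrow> d (f x) (f' x) \<le> a" "\<And>x. x \<in> M \<Longrightarrow> d (g x) (g' x) \<le> b"
    using assms by (auto simp: QI_rel_def qi_equivalent_def)
  obtain l e where l: "l \<ge> 1"
    "\<And>x y. x \<in> M \<Longrightarrow> y \<in> M \<Longrightarrow> d (f x) (f y) \<le> l * d x y + e"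
    using fg(1) by (rule QI_mapsE) blast
  have "d (f (g x)) (f' (g' x)) \<le> (l * b + e) + a" if x: "x \<in> M" for x
  proof -
    have "d (f (g x)) (f' (g' x)) \<le> d (f (g x)) (f (g' x)) + d (f (g' x)) (f' (g' x))"
      by (intro triangle in_M x)
    moreover have "d (f (g x)) (f (g' x)) \<le> l * d (g x) (g' x) + e"
      by (intro l(2) in_M x)
    moreover have "l * d (g x) (g' x) \<le> l * b"
      using ab(2)[OF x] l(1) by (intro mult_left_mono) auto
    moreover have "d (f (g' x)) (f' (g' x)) \<le> a"
      by (intro ab(1) in_M x)
    ultimately show ?thesis by linarith
  qed
  then show ?thesis
    using fg by (auto simp: QI_rel_def qi_equivalent_def QI_maps_compose compose_eq)
qed

lemma QI_class_eq_iff: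
  assumes "f \<in> QI_maps M d" "g \<in> QI_maps M d"
  shows "QI_class M d f = QI_class M d g \<longleftrightarrow> qi_equivalent M d f g"
  using eq_equiv_class_iff[OF equiv_QI_rel assms] assms
  by (simp add: QI_class_def QI_rel_def)

lemma QI_class_mult:
  assumes "f \<in> QI_maps M d" "g \<in> QI_maps M d"
  shows "QI_class M d f \<otimes>\<^bsub>QI_group M d\<^esub> QI_class M d g = QI_class M d (compose M f g)"
proof -
  have "congruent2 (QI_rel M d) (QI_rel M d) (\<lambda>f g. QI_class M d (compose M f g))"
    unfolding QI_class_def
    by (intro congruent2I' equiv_class_eq[OF equiv_QI_rel] QI_rel_compose)
  from UN_equiv_class2[OF equiv_QI_rel equiv_QI_rel this assms]
  show ?thesis by (simp add: QI_group_def QI_class_def)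
qed

lemma QI_class_in_carrier: "f \<in> QI_maps M d \<Longrightarrow> QI_class M d f \<in> carrier (QI_group M d)"
  by (simp add: QI_group_def QI_class_def quotientI)

lemma QI_groupE:
  assumes "A \<in> carrier (QI_group M d)"
  obtains f where "f \<in> QI_maps M d" "A = QI_class M d f"
  using assms by (auto simp: QI_group_def QI_class_def elim: quotientE)

lemma quasi_inverse:
  assumes "f \<in> QI_maps M d"
  obtains g where "g \<in> QI_maps M d" "qi_equivalent M d (compose M g f) (\<lambda>x \<in> M. x)"
proof -
  obtain l e C where f: "f \<in> extensional M" "f \<in> M \<rightarrow> M" "l \<ge> 1" "e \<ge> 0" "C \<ge> 0"
    "\<And>x y. x \<in> M \<Longrightarrow> y \<in> M \<Longrightarrow> d x y \<le> l * d (f x) (f y) + e"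
    "\<And>x y. x \<in> M \<Longrightarrow> y \<in> M \<Longrightarrow> d (f x) (f y) \<le> l * d x y + e"
    "\<And>z. z \<in> M \<Longrightarrow> \<exists>x \<in> M. d z (f x) \<le> C"
    using assms by (rule QI_mapsE) blast
  obtain h where h: "\<And>z. z \<in> M \<Longrightarrow> h z \<in> M" "\<And>z. z \<in> M \<Longrightarrow> d z (f (h z)) \<le> C"
    using f(8) by metis
  define g where "g = restrict h M"
  have g: "g z \<in> M" "d z (f (g z)) \<le> C" if "z \<in> M" for z
    using h that by (auto simp: g_def)
  have fM: "f x \<in> M" if "x \<in> M" for x using f(2) that by auto
  have close: "d (g (f x)) x \<le> l * C + e" if x: "x \<in> M" for x
  proof -
    have "d (g (f x)) x \<le> l * d (f (g (f x))) (f x) + e"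
      by (intro f(6) g(1) fM x)
    also have "d (f (g (f x))) (f x) \<le> C"
      using g(2)[OF fM[OF x]] by (simp add: commute)
    finally show ?thesis using f(3) by (simp add: mult_left_mono)
  qed
  have le: "l * (2 * C) + e \<ge> 0" "2 * C \<le> l * (2 * C)"
    using f(3-5) by (auto simp: mult_le_cancel_right1)
  have "g \<in> QI_maps M d"
  proof (rule QI_mapsI[where l = l and e = "l * (2 * C) + e" and C = "l * C + e"])
    fix x y assume xy: "x \<in> M" "y \<in> M"
    note M = xy g(1)[OF xy(1)] g(1)[OF xy(2)] fM[OF g(1)[OF xy(1)]] fM[OF g(1)[OF xy(2)]]
    have t1: "d x y \<le> d (f (g x)) (f (g y)) + 2 * C"
      using triangle[of x "f (g x)" y] triangle[of "f (g x)" "f (g y)" y]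
        g(2)[OF xy(1)] g(2)[OF xy(2)] commute[of y "f (g y)"] M by auto
    have t2: "d (f (g x)) (f (g y)) \<le> d x y + 2 * C"
      using triangle[of "f (g x)" x "f (g y)"] triangle[of x y "f (g y)"]
        g(2)[OF xy(1)] g(2)[OF xy(2)] commute[of x "f (g x)"] M by auto
    have "d (f (g x)) (f (g y)) \<le> l * d (g x) (g y) + e" using f(7) M by blast
    with t1 le show "d x y \<le> l * d (g x) (g y) + (l * (2 * C) + e)" by linarith
    have "d (g x) (g y) \<le> l * d (f (g x)) (f (g y)) + e" using f(6) M by blast
    also have "l * d (f (g x)) (f (g y)) \<le> l * (d x y + 2 * C)"
      using t2 f(3) by (intro mult_left_mono) auto
    finally show "d (g x) (g y) \<le> l * d x y + (l * (2 * C) + e)" by (simp add: algebra_simps)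
  next
    fix z assume "z \<in> M"
    then show "\<exists>x \<in> M. d z (g x) \<le> l * C + e"
      using close[of z] fM[of z] by (metis commute)
  qed (use f le g in \<open>auto simp: g_def\<close>)
  moreover have "qi_equivalent M d (compose M g f) (\<lambda>x \<in> M. x)"
    using close by (auto simp: qi_equivalent_def compose_eq)
  ultimately show thesis using that by blast
qed

lemma group_QI_group: "group (QI_group M d)"
proof (rule groupI)
  have one: "\<one>\<^bsub>QI_group M d\<^esub> = QI_class M d (\<lambda>x \<in> M. x)"
    by (simp add: QI_group_def)
  show "\<one>\<^bsub>QI_group M d\<^esub> \<in> carrier (QI_group M d)"
    by (simp add: one QI_class_in_carrier QI_maps_id)
  fix A assume "A \<in> carrier (QI_group M d)"
  then obtain f where f: "f \<in> QI_maps M d" "A = QI_class M d f" by (rule QI_groupE)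
  then have ext: "f \<in> extensional M" "f \<in> M \<rightarrow> M"
    by (auto simp: QI_maps_def quasi_isometry_def)
  show "\<one>\<^bsub>QI_group M d\<^esub> \<otimes>\<^bsub>QI_group M d\<^esub> A = A"
    using f ext by (simp add: one QI_class_mult QI_maps_id Id_compose)
  obtain g where g: "g \<in> QI_maps M d" "qi_equivalent M d (compose M g f) (\<lambda>x \<in> M. x)"
    using f(1) by (rule quasi_inverse)
  then show "\<exists>B \<in> carrier (QI_group M d). B \<otimes>\<^bsub>QI_group M d\<^esub> A = \<one>\<^bsub>QI_group M d\<^esub>"
    using f by (intro bexI[of _ "QI_class M d g"])
      (auto simp: one QI_class_mult QI_class_eq_iff QI_maps_compose QI_maps_id
        QI_class_in_carrier)
  fix B assume "B \<in> carrier (QI_group M d)"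
  then obtain g where g: "g \<in> QI_maps M d" "B = QI_class M d g" by (rule QI_groupE)
  show "A \<otimes>\<^bsub>QI_group M d\<^esub> B \<in> carrier (QI_group M d)"
    using f g by (simp add: QI_class_mult QI_class_in_carrier QI_maps_compose)
  fix C assume "C \<in> carrier (QI_group M d)"
  then obtain h where h: "h \<in> QI_maps M d" "C = QI_class M d h" by (rule QI_groupE)
  have "h \<in> M \<rightarrow> M" using h by (auto simp: QI_maps_def quasi_isometry_def)
  then have "compose M (compose M f g) h = compose M f (compose M g h)"
    by (metis compose_assoc)
  then show "A \<otimes>\<^bsub>QI_group M d\<^esub> B \<otimes>\<^bsub>QI_group M d\<^esub> C =
      A \<otimes>\<^bsub>QI_group M d\<^esub> (B \<otimes>\<^bsub>QI_group M d\<^esub> C)"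
    using f g h by (simp add: QI_class_mult QI_maps_compose)
qed

end

locale group_with_generators = group G for G (structure) +
  fixes S :: "'a set"
  assumes S_carrier: "S \<subseteq> carrier G" and generate_S: "generate G S = carrier G"
begin

lemma letters_closed: "S \<union> m_inv G ` S \<subseteq> carrier G"
  using S_carrier by auto

lemma word_closed: "set ws \<subseteq> S \<union> m_inv G ` S \<Longrightarrow> foldr (\<otimes>) ws \<one> \<in> carrier G"
proof (induction ws)
  case (Cons a ws)
  then have "a \<in> carrier G" "foldr (\<otimes>) ws \<one> \<in> carrier G"
    using letters_closed by (auto simp del: Un_iff)
  then show ?case by simp
qed simp

lemma word_append:
  assumes "set us \<subseteq> S \<union> m_inv G ` S" "set vs \<subseteq> S \<union> m_inv G ` S"
  shows "foldr (\<otimes>) (us @ vs) \<one> = foldr (\<otimes>) us \<one> \<otimes> foldr (\<otimes>) vs \<one>"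
  using assms
proof (induction us)
  case (Cons a us)
  then show ?case
    using letters_closed word_closed[of us] word_closed[of vs] by (auto simp: m_assoc)
qed (simp add: word_closed)

lemma letters_inv: "a \<in> S \<union> m_inv G ` S \<Longrightarrow> inv a \<in> S \<union> m_inv G ` S"
  using S_carrier by auto

lemma word_inv_letters:
  "set ws \<subseteq> S \<union> m_inv G ` S \<Longrightarrow> set (rev (map (m_inv G) ws)) \<subseteq> S \<union> m_inv G ` S"
  using letters_inv by auto

lemma word_inv:
  assumes "set ws \<subseteq> S \<union> m_inv G ` S"
  shows "foldr (\<otimes>) (rev (map (m_inv G) ws)) \<one> = inv (foldr (\<otimes>) ws \<one>)"
  using assms
proof (induction ws)
  case (Cons a ws)
  have a: "a \<in> carrier G" "inv a \<in> S \<union> m_inv G ` S" "set ws \<subseteq> S \<union> m_inv G ` S"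
    using Cons.prems letters_closed letters_inv[of a] by auto
  have "foldr (\<otimes>) (rev (map (m_inv G) ws) @ [inv a]) \<one> = inv (foldr (\<otimes>) ws \<one>) \<otimes> inv a"
    using word_append[of "rev (map (m_inv G) ws)" "[inv a]"] word_inv_letters[of ws] a Cons.IH by simp
  then show ?case
    using a word_closed[of ws] by (simp add: inv_mult_group)
qed simp

lemma word_exists:
  assumes "g \<in> carrier G"
  shows "\<exists>ws. set ws \<subseteq> S \<union> m_inv G ` S \<and> foldr (\<otimes>) ws \<one> = g"
proof -
  have "g \<in> generate G S" using assms generate_S by simp
  then show ?thesis
  proof (induction rule: generate.induct)
    case one
    show ?case by (intro exI[of _ "[]"]) simp
  next
    case (incl h)
    then show ?case using S_carrier by (intro exI[of _ "[h]"]) auto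
  next
    case (inv h)
    then show ?case using S_carrier by (intro exI[of _ "[inv h]"]) auto
  next
    case (eng h1 h2)
    then obtain us vs where "set us \<subseteq> S \<union> m_inv G ` S" "foldr (\<otimes>) us \<one> = h1"
      "set vs \<subseteq> S \<union> m_inv G ` S" "foldr (\<otimes>) vs \<one> = h2" by blast
    then show ?case using word_append[of us vs] by (intro exI[of _ "us @ vs"]) simp
  qed
qed

lemma word_length_attained:
  assumes "g \<in> carrier G"
  obtains ws where "set ws \<subseteq> S \<union> m_inv G ` S" "foldr (\<otimes>) ws \<one> = g"
    "length ws = word_length G S g"
proof -
  have "\<exists>n ws. length ws = n \<and> set ws \<subseteq> S \<union> m_inv G ` S \<and> foldr (\<otimes>) ws \<one> = g"
    using word_exists[OF assms] by blast
  from LeastI_ex[OF this] show thesis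
    using that unfolding word_length_def by blast
qed

lemma word_length_le:
  "set ws \<subseteq> S \<union> m_inv G ` S \<Longrightarrow> word_length G S (foldr (\<otimes>) ws \<one>) \<le> length ws"
  unfolding word_length_def by (rule Least_le) blast

lemma word_length_mult:
  assumes "g \<in> carrier G" "h \<in> carrier G"
  shows "word_length G S (g \<otimes> h) \<le> word_length G S g + word_length G S h"
  by (metis assms le_sup_iff length_append set_append word_append word_length_attained
      word_length_le)

lemma word_length_inv_le:
  assumes "g \<in> carrier G"
  shows "word_length G S (inv g) \<le> word_length G S g"
proof -
  obtain ws where "set ws \<subseteq> S \<union> m_inv G ` S" "foldr (\<otimes>) ws \<one> = g"
    "length ws = word_length G S g" using assms by (rule word_length_attained)
  then show ?thesis using word_inv[of ws] word_inv_letters[of ws] word_length_le[of "rev (map (m_inv G) ws)"] by simp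
qed

lemma word_length_inv:
  "g \<in> carrier G \<Longrightarrow> word_length G S (inv g) = word_length G S g"
  using word_length_inv_le[of g] word_length_inv_le[of "inv g"] by simp

lemma word_length_eq_0_iff:
  assumes "g \<in> carrier G"
  shows "word_length G S g = 0 \<longleftrightarrow> g = \<one>"
proof
  assume 0: "word_length G S g = 0"
  obtain ws where "foldr (\<otimes>) ws \<one> = g" "length ws = word_length G S g"
    using assms by (rule word_length_attained)
  with 0 show "g = \<one>" by simp
next
  assume "g = \<one>"
  then show "word_length G S g = 0" using word_length_le[of "[]"] by simp
qed

lemma Metric_space_word_dist: "Metric_space (carrier G) (word_dist G S)"
proof
  fix x y z
  show "0 \<le> word_dist G S x y" by (simp add: word_dist_def)
  have "word_length G S (inv x \<otimes> y) = word_length G S (inv y \<otimes> x)"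
    if "x \<in> carrier G" "y \<in> carrier G"
    using that word_length_inv[of "inv x \<otimes> y"] by (simp add: inv_mult_group)
  then show "word_dist G S x y = word_dist G S y x" by (simp add: word_dist_def)
  assume xy: "x \<in> carrier G" "y \<in> carrier G"
  have "inv x \<otimes> y = \<one> \<longleftrightarrow> x = y"
    using xy by (metis inv_closed inv_equality inv_inv l_inv)
  then show "word_dist G S x y = 0 \<longleftrightarrow> x = y"
    using xy by (simp add: word_dist_def word_length_eq_0_iff)
  assume z: "z \<in> carrier G"
  have "inv x \<otimes> z = (inv x \<otimes> y) \<otimes> (inv y \<otimes> z)"
    using xy z by (metis inv_closed m_assoc m_closed r_inv r_one l_one)
  then show "word_dist G S x z \<le> word_dist G S x y + word_dist G S y z"
    using word_length_mult[of "inv x \<otimes> y" "inv y \<otimes> z"] xy z by (simp add: word_dist_def)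
qed

sublocale word: Metric_space "carrier G" "word_dist G S"
  by (rule Metric_space_word_dist)

lemma auto_word_length_bound:
  assumes "finite S" "\<phi> \<in> auto G"
  obtains L where "L \<ge> 1"
    "\<And>g. g \<in> carrier G \<Longrightarrow> word_length G S (\<phi> g) \<le> L * word_length G S g"
proof -
  interpret \<phi>: group_hom G G \<phi>
    using assms(2) by (unfold_locales) (auto simp: auto_def)
  define L where "L = Suc (Max ((\<lambda>a. word_length G S (\<phi> a)) ` (S \<union> m_inv G ` S \<union> {\<one>})))"
  have L: "word_length G S (\<phi> a) \<le> L" if "a \<in> S \<union> m_inv G ` S" for a
    unfolding L_def using that assms(1) by (intro le_SucI Max_ge) auto
  have *: "word_length G S (\<phi> (foldr (\<otimes>) ws \<one>)) \<le> L * length ws"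
    if "set ws \<subseteq> S \<union> m_inv G ` S" for ws
    using that
  proof (induction ws)
    case Nil
    show ?case by (simp add: word_length_eq_0_iff)
  next
    case (Cons a ws)
    have a: "a \<in> S \<union> m_inv G ` S" "a \<in> carrier G" "foldr (\<otimes>) ws \<one> \<in> carrier G"
      using Cons.prems letters_closed word_closed[of ws] by auto
    then have "word_length G S (\<phi> (a \<otimes> foldr (\<otimes>) ws \<one>)) \<le>
        word_length G S (\<phi> a) + word_length G S (\<phi> (foldr (\<otimes>) ws \<one>))"
      by (simp add: word_length_mult)
    with L[OF a(1)] Cons show ?case by simp
  qed
  show thesis
  proof (rule that[of L])
    show "L \<ge> 1" by (simp add: L_def)
    fix g assume "g \<in> carrier G"
    then obtain ws where "set ws \<subseteq> S \<union> m_inv G ` S" "foldr (\<otimes>) ws \<one> = g"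
      "length ws = word_length G S g" by (rule word_length_attained)
    with *[of ws] show "word_length G S (\<phi> g) \<le> L * word_length G S g" by simp
  qed
qed

lemma auto_QI_maps:
  assumes "finite S" "\<phi> \<in> auto G"
  shows "\<phi> \<in> QI_maps (carrier G) (word_dist G S)"
proof -
  have bound: "\<exists>L \<ge> 1. \<forall>x \<in> carrier G. \<forall>y \<in> carrier G.
      word_dist G S (\<psi> x) (\<psi> y) \<le> L * word_dist G S x y" if \<psi>: "\<psi> \<in> auto G" for \<psi>
  proof -
    interpret \<psi>: group_hom G G \<psi>
      using \<psi> by (unfold_locales) (auto simp: auto_def)
    obtain L where L: "L \<ge> 1"
      "\<And>g. g \<in> carrier G \<Longrightarrow> word_length G S (\<psi> g) \<le> L * word_length G S g"
      using assms(1) \<psi> by (rule auto_word_length_bound) blast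
    have "word_dist G S (\<psi> x) (\<psi> y) \<le> real L * word_dist G S x y"
      if "x \<in> carrier G" "y \<in> carrier G" for x y
    proof -
      have "word_length G S (inv (\<psi> x) \<otimes> \<psi> y) \<le> L * word_length G S (inv x \<otimes> y)"
        using L(2)[of "inv x \<otimes> y"] that by simp
      then have "real (word_length G S (inv (\<psi> x) \<otimes> \<psi> y)) \<le>
          real (L * word_length G S (inv x \<otimes> y))"
        by (rule of_nat_mono)
      then show ?thesis using that by (simp add: word_dist_def)
    qed
    with L(1) show ?thesis by (intro exI[of _ "real L"]) auto
  qed
  obtain L where L: "L \<ge> 1" "\<And>x y. x \<in> carrier G \<Longrightarrow> y \<in> carrier G \<Longrightarrow>
      word_dist G S (\<phi> x) (\<phi> y) \<le> L * word_dist G S x y"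
    using bound[OF assms(2)] by blast
  define \<psi> where "\<psi> = restrict (inv_into (carrier G) \<phi>) (carrier G)"
  have bij: "bij_betw \<phi> (carrier G) (carrier G)" "\<phi> \<in> extensional (carrier G)"
    using assms(2) by (auto simp: auto_def Bij_def)
  have "\<psi> \<in> auto G"
    using assms(2) by (auto simp: \<psi>_def auto_def restrict_inv_into_hom restrict_inv_into_Bij)
  then obtain L' where L': "L' \<ge> 1" "\<And>x y. x \<in> carrier G \<Longrightarrow> y \<in> carrier G \<Longrightarrow>
      word_dist G S (\<psi> x) (\<psi> y) \<le> L' * word_dist G S x y"
    using bound by blast
  have inv: "\<psi> (\<phi> x) = x" "\<phi> (\<psi> x) = x" "\<phi> x \<in> carrier G" "\<psi> x \<in> carrier G"
    if "x \<in> carrier G" for x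
    using that bij(1) bij_betwE[OF bij(1)] bij_betwE[OF bij_betw_inv_into[OF bij(1)]]
    by (auto simp: \<psi>_def bij_betw_inv_into_left bij_betw_inv_into_right)
  show ?thesis
  proof (rule QI_mapsI[where l = "max L L'" and e = 0 and C = 0])
    fix x y assume xy: "x \<in> carrier G" "y \<in> carrier G"
    have "word_dist G S x y \<le> L' * word_dist G S (\<phi> x) (\<phi> y)"
      using L'(2)[of "\<phi> x" "\<phi> y"] inv xy by simp
    also have "\<dots> \<le> max L L' * word_dist G S (\<phi> x) (\<phi> y)"
      by (intro mult_right_mono) auto
    finally show "word_dist G S x y \<le> max L L' * word_dist G S (\<phi> x) (\<phi> y) + 0" by simp
    have "word_dist G S (\<phi> x) (\<phi> y) \<le> L * word_dist G S x y" using L(2) xy .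
    also have "\<dots> \<le> max L L' * word_dist G S x y"
      by (intro mult_right_mono) auto
    finally show "word_dist G S (\<phi> x) (\<phi> y) \<le> max L L' * word_dist G S x y + 0" by simp
  next
    fix z assume "z \<in> carrier G"
    then show "\<exists>x \<in> carrier G. word_dist G S z (\<phi> x) \<le> 0"
      using inv[of z] by (intro bexI[of _ "\<psi> z"]) auto
  qed (use L L' bij inv in auto)
qed

lemma theta_hom:
  assumes "finite S"
  shows "theta G S \<in> hom (AutoGroup G) (QI G S)"
proof (rule homI)
  have carrier: "carrier (AutoGroup G) = auto G" by (simp add: AutoGroup_def)
  fix \<phi> assume \<phi>: "\<phi> \<in> carrier (AutoGroup G)"
  then show "theta G S \<phi> \<in> carrier (QI G S)"
    using auto_QI_maps[OF assms] word.QI_class_in_carrier by (simp add: theta_def carrier)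
  fix \<psi> assume \<psi>: "\<psi> \<in> carrier (AutoGroup G)"
  have "\<phi> \<otimes>\<^bsub>AutoGroup G\<^esub> \<psi> = compose (carrier G) \<phi> \<psi>"
    using \<phi> \<psi> by (simp add: carrier) (simp add: AutoGroup_def BijGroup_def auto_def)
  then show "theta G S (\<phi> \<otimes>\<^bsub>AutoGroup G\<^esub> \<psi>) = theta G S \<phi> \<otimes>\<^bsub>QI G S\<^esub> theta G S \<psi>"
    using \<phi> \<psi> auto_QI_maps[OF assms] by (simp add: theta_def carrier word.QI_class_mult)
qed

end

end

theory Submission
  imports Defs
begin

text \<open>
  The word metric is left invariant, so the distance from \<open>\<phi> x\<close> to \<open>\<psi> x\<close> is the length of the
  quotient \<open>t x = (\<phi> x)\<inverse> (\<psi> x)\<close>.  Balls are finite because the generating set is.  Hence two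
  automorphisms \<open>\<phi>\<close>, \<open>\<psi>\<close> have the same class in \<open>QI(G)\<close> exactly when \<open>t\<close> takes only finitely
  many values (\<open>theta_eq_iff_finite\<close>).  On the other hand, \<open>a\<close> lies in the FC-centre exactly when
  it has only finitely many conjugates (\<open>FC_center_iff_finite_conjugates\<close>).  The theorem compares
  these two finiteness conditions.

  If \<open>\<phi>\<close> is the identity and \<open>\<psi>\<close> is conjugation by \<open>a\<close>, then \<open>t x = (x\<inverse> a x) a\<inverse>\<close>, so the values
  of \<open>t\<close> are the conjugates of \<open>a\<close> up to translation.  Conjugation by an element of the FC-centre
  therefore has trivial class, and if \<open>\<theta>\<close> is injective the element is central.

  Conversely, let \<open>t\<close> take finitely many values.  The cocycle identity
  \<open>t (x y) = ((\<phi> y)\<inverse> (t x) (\<phi> y)) (t y)\<close> writes each conjugate of \<open>t x\<close> by an element \<open>\<phi> y\<close> as a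
  quotient of two values of \<open>t\<close>.  As \<open>\<phi>\<close> is onto, \<open>t x\<close> has finitely many conjugates
  (\<open>finite_auto_quotients_in_FC_center\<close>).  If the FC-centre is the centre, \<open>t x\<close> is central and
  the identity becomes \<open>t (x y) = (t x) (t y)\<close>.  A homomorphism with finite range has torsion
  values, so \<open>t\<close> is trivial when the centre is torsion free, and then \<open>\<phi> = \<psi>\<close>.
\<close>

section \<open>Conjugates and the FC-centre\<close>

context group
begin

lemma conjugate_eq_iff:
  assumes "a \<in> carrier G" "b \<in> carrier G" "c \<in> carrier G"
  shows "inv c \<otimes> a \<otimes> c = b \<longleftrightarrow> a \<otimes> c = c \<otimes> b"
  using assms by (metis inv_closed inv_solve_left m_assoc m_closed)

text \<open>Two elements conjugate \<open>a\<close> to the same element exactly when their quotient commutes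
  with \<open>a\<close>.\<close>

lemma rcos_centralizer_eq_fibre:
  assumes a: "a \<in> carrier G" and x: "x \<in> carrier G"
  shows "centralizer G a #> x =
    {y \<in> carrier G. inv y \<otimes> a \<otimes> y = inv x \<otimes> a \<otimes> x}" (is "_ = ?F")
proof
  show "centralizer G a #> x \<subseteq> ?F"
  proof
    fix y assume "y \<in> centralizer G a #> x"
    then obtain c where c: "c \<in> carrier G" "c \<otimes> a = a \<otimes> c" "y = c \<otimes> x"
      by (auto simp: r_coset_def centralizer_def)
    have "a \<otimes> (c \<otimes> x) = c \<otimes> a \<otimes> x"
      using a x c by (simp add: m_assoc)
    also have "\<dots> = c \<otimes> x \<otimes> (inv x \<otimes> a \<otimes> x)"
      using a x c by (simp add: m_assoc) (metis inv_closed l_one m_assoc m_closed r_inv)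
    finally show "y \<in> ?F"
      using a x c by (simp add: conjugate_eq_iff)
  qed
  show "?F \<subseteq> centralizer G a #> x"
  proof
    fix y assume "y \<in> ?F"
    then have y: "y \<in> carrier G" "a \<otimes> y = y \<otimes> (inv x \<otimes> a \<otimes> x)"
      using a x conjugate_eq_iff[of a "inv x \<otimes> a \<otimes> x" y] by auto
    have "y \<otimes> inv x \<otimes> a = y \<otimes> (inv x \<otimes> a \<otimes> x) \<otimes> inv x"
      using a x y(1) by (simp add: m_assoc)
    also have "\<dots> = a \<otimes> (y \<otimes> inv x)"
      using a x y(1) by (subst y(2)[symmetric]) (simp add: m_assoc)
    finally have "y \<otimes> inv x \<in> centralizer G a"
      using a x y(1) by (simp add: centralizer_def)
    moreover have "y = y \<otimes> inv x \<otimes> x"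
      using x y(1) by (simp add: m_assoc)
    ultimately show "y \<in> centralizer G a #> x"
      by (auto simp: r_coset_def)
  qed
qed

text \<open>Sending a conjugate of \<open>a\<close> to the set of its conjugators is a bijection onto the cosets
  of the centralizer: orbit and stabilizer for the conjugation action.\<close>

lemma FC_center_iff_finite_conjugates:
  "a \<in> FC_center G \<longleftrightarrow>
    a \<in> carrier G \<and> finite ((\<lambda>x. inv x \<otimes> a \<otimes> x) ` carrier G)"
proof (cases "a \<in> carrier G")
  case True
  define fibre where "fibre b = {y \<in> carrier G. inv y \<otimes> a \<otimes> y = b}" for b
  have "rcosets (centralizer G a) = fibre ` (\<lambda>x. inv x \<otimes> a \<otimes> x) ` carrier G"
    using rcos_centralizer_eq_fibre[OF True] by (auto simp: RCOSETS_def fibre_def)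
  moreover have "inj_on fibre ((\<lambda>x. inv x \<otimes> a \<otimes> x) ` carrier G)"
    by (rule inj_onI) (auto simp: fibre_def)
  ultimately show ?thesis
    using True by (simp add: FC_center_def finite_image_iff)
qed (simp add: FC_center_def)

lemma center_subset_FC_center: "center G \<subseteq> FC_center G"
proof
  fix z assume z: "z \<in> center G"
  then have "inv x \<otimes> z \<otimes> x = z" if "x \<in> carrier G" for x
    using that by (auto simp: center_def conjugate_eq_iff)
  then have "(\<lambda>x. inv x \<otimes> z \<otimes> x) ` carrier G \<subseteq> {z}"
    by auto
  then show "z \<in> FC_center G"
    using z by (auto simp: FC_center_iff_finite_conjugates center_def intro: finite_subset)
qed

lemma inner_automorphism:
  assumes "a \<in> carrier G"
  shows "(\<lambda>x \<in> carrier G. a \<otimes> x \<otimes> inv a) \<in> auto G"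
proof -
  have "(a \<otimes> x \<otimes> inv a) \<otimes> (a \<otimes> y \<otimes> inv a) = a \<otimes> (x \<otimes> y) \<otimes> inv a"
    if "x \<in> carrier G" "y \<in> carrier G" for x y
    using assms that by (simp add: m_assoc) (metis inv_closed l_inv l_one m_assoc m_closed)
  then have "(\<lambda>x \<in> carrier G. a \<otimes> x \<otimes> inv a) \<in> hom G G"
    using assms by (auto intro!: homI)
  then show ?thesis
    using conjugation_is_bij[OF assms] by (simp add: auto_def Bij_def)
qed

text \<open>Powers of \<open>t x\<close> are the values of \<open>t\<close> at powers of \<open>x\<close>, so finiteness of the range forces
  two of them to coincide.\<close>

lemma hom_finite_range_torsion:
  assumes t: "t \<in> hom G G" and fin: "finite (t ` carrier G)" and x: "x \<in> carrier G"
  obtains n :: nat where "n > 0" "t x [^] n = \<one>"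
proof -
  interpret t: group_hom G G t
    using t by unfold_locales
  have "range (\<lambda>n::nat. t x [^] n) \<subseteq> t ` carrier G"
    using x by (auto simp flip: t.hom_nat_pow)
  then have "\<not> inj (\<lambda>n::nat. t x [^] n)"
    using fin finite_imageD finite_subset infinite_UNIV_nat by blast
  then obtain m n :: nat where mn: "t x [^] m = t x [^] n" "m \<noteq> n"
    by (auto simp: inj_on_def)
  have "\<exists>k::nat. k > 0 \<and> t x [^] k = \<one>" if "t x [^] m = t x [^] n" "m < n" for m n :: nat
    using that x pow_eq_div2[of "t x" n m] t.hom_closed[OF x]
    by (intro exI[of _ "n - m"]) auto
  then show thesis
    using mn that by (metis nat_neq_iff)
qed

end

section \<open>Automorphisms at bounded distance\<close>

context group_with_generators
begin

text \<open>There are only finitely many words of bounded length in finitely many letters.\<close>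

lemma finite_word_ball:
  assumes "finite S"
  shows "finite {g \<in> carrier G. word_length G S g \<le> n}"
proof -
  let ?W = "{ws. set ws \<subseteq> S \<union> m_inv G ` S \<and> length ws \<le> n}"
  have "{g \<in> carrier G. word_length G S g \<le> n} \<subseteq> (\<lambda>ws. foldr (\<otimes>) ws \<one>) ` ?W"
  proof
    fix g assume g: "g \<in> {g \<in> carrier G. word_length G S g \<le> n}"
    then obtain ws where "set ws \<subseteq> S \<union> m_inv G ` S" "foldr (\<otimes>) ws \<one> = g"
      "length ws = word_length G S g" using word_length_attained[of g] by auto
    with g show "g \<in> (\<lambda>ws. foldr (\<otimes>) ws \<one>) ` ?W" by auto
  qed
  moreover have "finite ?W"
    using assms by (intro finite_lists_length_le) auto
  ultimately show ?thesis
    by (meson finite_imageI finite_subset)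
qed

text \<open>The distance from \<open>f x\<close> to \<open>g x\<close> is the length of \<open>(f x)\<inverse> (g x)\<close>, and a set of group
  elements is finite exactly when its lengths are bounded.\<close>

lemma qi_equivalent_iff_finite:
  assumes "finite S" and f: "f \<in> carrier G \<rightarrow> carrier G" and g: "g \<in> carrier G \<rightarrow> carrier G"
  shows "qi_equivalent (carrier G) (word_dist G S) f g \<longleftrightarrow>
    finite ((\<lambda>x. inv (f x) \<otimes> g x) ` carrier G)"
proof
  assume "qi_equivalent (carrier G) (word_dist G S) f g"
  then obtain c where c: "\<And>x. x \<in> carrier G \<Longrightarrow> word_dist G S (f x) (g x) \<le> c"
    by (auto simp: qi_equivalent_def)
  have "word_length G S (inv (f x) \<otimes> g x) \<le> nat \<lfloor>c\<rfloor>" if "x \<in> carrier G" for x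
    using c[OF that] that f g by (simp add: word_dist_def Pi_iff le_nat_floor)
  then have "(\<lambda>x. inv (f x) \<otimes> g x) ` carrier G \<subseteq>
      {h \<in> carrier G. word_length G S h \<le> nat \<lfloor>c\<rfloor>}"
    using f g by auto
  then show "finite ((\<lambda>x. inv (f x) \<otimes> g x) ` carrier G)"
    using finite_word_ball[OF assms(1)] by (rule finite_subset)
next
  assume fin: "finite ((\<lambda>x. inv (f x) \<otimes> g x) ` carrier G)"
  let ?L = "word_length G S ` (\<lambda>x. inv (f x) \<otimes> g x) ` carrier G"
  have "word_dist G S (f x) (g x) \<le> real (Max ?L)" if "x \<in> carrier G" for x
    using fin that f g by (auto simp: word_dist_def Pi_iff intro!: Max_ge)
  then show "qi_equivalent (carrier G) (word_dist G S) f g"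
    by (auto simp: qi_equivalent_def)
qed

lemma theta_eq_iff_finite:
  assumes "finite S" and "\<phi> \<in> auto G" and "\<psi> \<in> auto G"
  shows "theta G S \<phi> = theta G S \<psi> \<longleftrightarrow> finite ((\<lambda>x. inv (\<phi> x) \<otimes> \<psi> x) ` carrier G)"
proof -
  have "\<phi> \<in> carrier G \<rightarrow> carrier G" "\<psi> \<in> carrier G \<rightarrow> carrier G"
    using assms(2,3) by (auto simp: auto_def hom_def)
  then show ?thesis
    using assms auto_QI_maps
    by (simp add: theta_def word.QI_class_eq_iff qi_equivalent_iff_finite)
qed

text \<open>The quotient of \<open>x\<close> and its image is \<open>(x\<inverse> a x) a\<inverse>\<close>, so it takes finitely many values.\<close>

lemma theta_inner_automorphism:
  assumes "finite S" and a: "a \<in> FC_center G"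
  shows "theta G S (\<lambda>x \<in> carrier G. a \<otimes> x \<otimes> inv a) = theta G S (\<lambda>x \<in> carrier G. x)"
proof -
  have aG: "a \<in> carrier G"
    using a by (simp add: FC_center_def)
  have "(\<lambda>x. inv ((\<lambda>x \<in> carrier G. x) x) \<otimes> (\<lambda>x \<in> carrier G. a \<otimes> x \<otimes> inv a) x) ` carrier G
      = (\<lambda>b. b \<otimes> inv a) ` (\<lambda>x. inv x \<otimes> a \<otimes> x) ` carrier G"
    unfolding image_image using aG by (intro image_cong) (simp_all add: m_assoc)
  also have "finite \<dots>"
    using a by (simp add: FC_center_iff_finite_conjugates)
  finally show ?thesis
    using theta_eq_iff_finite[OF assms(1) id_in_auto inner_automorphism[OF aG]] by simp
qed

lemma FC_center_eq_center_if_theta_mon: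
  assumes "finite S" and mon: "theta G S \<in> mon (AutoGroup G) (QI G S)"
  shows "FC_center G = center G"
proof
  show "FC_center G \<subseteq> center G"
  proof
    fix a assume a: "a \<in> FC_center G"
    then have aG: "a \<in> carrier G"
      by (simp add: FC_center_def)
    have "(\<lambda>x \<in> carrier G. a \<otimes> x \<otimes> inv a) = (\<lambda>x \<in> carrier G. x)"
      using mon id_in_auto theta_inner_automorphism[OF assms(1) a] inner_automorphism[OF aG]
      by (auto simp: mon_def AutoGroup_def dest: inj_onD)
    then have "a \<otimes> x \<otimes> inv a = x" if "x \<in> carrier G" for x
      using that by (metis restrict_apply')
    then show "a \<in> center G"
      using aG by (auto simp: center_def inv_solve_right')
  qed
qed (rule center_subset_FC_center)

end

section \<open>Automorphisms with finitely many quotients\<close>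

context group
begin

lemma auto_quotient_cocycle:
  assumes "\<phi> \<in> auto G" "\<psi> \<in> auto G" "x \<in> carrier G" "y \<in> carrier G"
  shows "inv (\<phi> (x \<otimes> y)) \<otimes> \<psi> (x \<otimes> y) =
    (inv (\<phi> y) \<otimes> (inv (\<phi> x) \<otimes> \<psi> x) \<otimes> \<phi> y) \<otimes> (inv (\<phi> y) \<otimes> \<psi> y)"
proof -
  interpret \<phi>: group_hom G G \<phi> using assms(1) by unfold_locales (simp add: auto_def)
  interpret \<psi>: group_hom G G \<psi> using assms(2) by unfold_locales (simp add: auto_def)
  have "\<phi> y \<otimes> (inv (\<phi> y) \<otimes> \<psi> y) = \<psi> y"
    using assms(3,4) by (simp flip: m_assoc)
  then show ?thesis
    using assms(3,4) by (simp add: m_assoc inv_mult_group)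
qed

text \<open>The cocycle identity expresses every conjugate of a quotient by an element \<open>\<phi> y\<close> through two
  quotients, and surjectivity of \<open>\<phi>\<close> makes these all its conjugates.\<close>

lemma finite_auto_quotients_in_FC_center:
  assumes \<phi>: "\<phi> \<in> auto G" and \<psi>: "\<psi> \<in> auto G"
    and fin: "finite ((\<lambda>x. inv (\<phi> x) \<otimes> \<psi> x) ` carrier G)"
    and x: "x \<in> carrier G"
  shows "inv (\<phi> x) \<otimes> \<psi> x \<in> FC_center G"
proof -
  interpret \<phi>: group_hom G G \<phi> using \<phi> by unfold_locales (simp add: auto_def)
  interpret \<psi>: group_hom G G \<psi> using \<psi> by unfold_locales (simp add: auto_def)
  define t where "t y = inv (\<phi> y) \<otimes> \<psi> y" for y
  have tG: "t y \<in> carrier G" if "y \<in> carrier G" for y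
    using that by (simp add: t_def)
  have surj: "\<phi> ` carrier G = carrier G"
    using \<phi> by (simp add: auto_def Bij_def bij_betw_def)
  have "inv (\<phi> y) \<otimes> t x \<otimes> \<phi> y = t (x \<otimes> y) \<otimes> inv (t y)" if y: "y \<in> carrier G" for y
    using auto_quotient_cocycle[OF \<phi> \<psi> x y, folded t_def] tG x y by (simp add: m_assoc)
  then have "(\<lambda>z. inv z \<otimes> t x \<otimes> z) ` \<phi> ` carrier G \<subseteq>
      (\<lambda>(a, b). a \<otimes> inv b) ` (t ` carrier G \<times> t ` carrier G)"
    using x by force
  moreover have "finite (t ` carrier G)"
    using fin by (simp add: t_def)
  ultimately have "finite ((\<lambda>z. inv z \<otimes> t x \<otimes> z) ` carrier G)"
    unfolding surj by (meson finite_SigmaI finite_imageI finite_subset)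
  then show ?thesis
    using tG[OF x] by (simp add: FC_center_iff_finite_conjugates t_def)
qed

text \<open>Once the quotients are central, the cocycle identity says that they form a homomorphism,
  and its finite range consists of torsion elements.\<close>

lemma autos_eq_if_finite_quotients:
  assumes \<phi>: "\<phi> \<in> auto G" and \<psi>: "\<psi> \<in> auto G"
    and fin: "finite ((\<lambda>x. inv (\<phi> x) \<otimes> \<psi> x) ` carrier G)"
    and FC: "FC_center G = center G" and tf: "torsion_free (G\<lparr>carrier := center G\<rparr>)"
  shows "\<phi> = \<psi>"
proof -
  interpret \<phi>: group_hom G G \<phi> using \<phi> by unfold_locales (simp add: auto_def)
  interpret \<psi>: group_hom G G \<psi> using \<psi> by unfold_locales (simp add: auto_def)
  define t where "t y = inv (\<phi> y) \<otimes> \<psi> y" for y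
  have tZ: "t x \<in> center G" if "x \<in> carrier G" for x
    using finite_auto_quotients_in_FC_center[OF \<phi> \<psi> fin that] FC by (simp add: t_def)
  then have tG: "t x \<in> carrier G" if "x \<in> carrier G" for x
    using that by (auto simp: center_def)
  have "inv (\<phi> y) \<otimes> t x \<otimes> \<phi> y = t x" if "x \<in> carrier G" "y \<in> carrier G" for x y
    using tZ[OF that(1)] that by (simp add: conjugate_eq_iff center_def)
  then have "t (x \<otimes> y) = t x \<otimes> t y" if "x \<in> carrier G" "y \<in> carrier G" for x y
    using auto_quotient_cocycle[OF \<phi> \<psi> that, folded t_def] that by simp
  then have hom: "t \<in> hom G G"
    using tG by (auto intro!: homI)
  have "t x = \<one>" if x: "x \<in> carrier G" for x
  proof -
    obtain n :: nat where "n > 0" "t x [^] n = \<one>"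
      using hom_finite_range_torsion[OF hom _ x] fin by (auto simp: t_def)
    then show ?thesis
      using tf tZ[OF x] by (auto simp: torsion_free_def nat_pow_def)
  qed
  then have "\<phi> x = \<psi> x" if "x \<in> carrier G" for x
    using that by (simp add: t_def) (metis \<phi>.hom_closed \<psi>.hom_closed inv_closed inv_equality inv_inv)
  moreover have "\<phi> \<in> extensional (carrier G)" "\<psi> \<in> extensional (carrier G)"
    using \<phi> \<psi> by (simp_all add: auto_def Bij_def)
  ultimately show ?thesis
    by (metis extensionalityI)
qed

end

theorem theorem1p1:
  fixes G :: "('a, 'b) monoid_scheme" and S :: "'a set"
  assumes "group G" and "infinite (carrier G)"
    and "finite S" and "S \<subseteq> carrier G" and "generate G S = carrier G"
  shows "(theta G S \<in> mon (AutoGroup G) (QI G S) \<longrightarrow> FC_center G = center G) \<and>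
         (FC_center G = center G \<and> torsion_free (G\<lparr>carrier := center G\<rparr>) \<longrightarrow>
            theta G S \<in> mon (AutoGroup G) (QI G S))"
proof -
  interpret group_with_generators G S
    using assms by (simp add: group_with_generators_def group_with_generators_axioms_def)
  have "theta G S \<in> mon (AutoGroup G) (QI G S)"
    if "FC_center G = center G" "torsion_free (G\<lparr>carrier := center G\<rparr>)"
    using theta_hom[OF assms(3)] that assms(3)
    by (auto simp: mon_def AutoGroup_def theta_eq_iff_finite
        intro!: inj_onI autos_eq_if_finite_quotients)
  then show ?thesis
    using FC_center_eq_center_if_theta_mon[OF assms(3)] by blast
qed

end
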